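(* Let $C_n^{(\nu)}(t)$ denote the Gegenbauer (ultraspherical) polynomials. The sequence of values $\left(C_n^{(\nu)}(t)\right)_{n\ge 0}$ is log-concave for all real $t\ge 1$, $\nu\ge 1$, and it is log-convex for all real $\nu, t$ with $0<\nu<1$ and $t\ge \max\left\{\frac{1}{\sqrt{2\nu}},\frac{1}{\sqrt{2(1-\nu)}}\right\}$.
   Context: The Gegenbauer polynomials $C_n^{(\nu)}(t)$, for a real parameter $\nu>-1/2$, are defined by $C_0^{(\nu)}(t)=1$, $C_1^{(\nu)}(t)=2\nu t$, and $nC_n^{(\nu)}(t)=2t(\nu+n-1)C_{n-1}^{(\nu)}(t)-(2\nu+n-2)C_{n-2}^{(\nu)}(t)$ for $n\ge 2$. A sequence $(a(n))_{n\ge 0}$ of real numbers is log-concave if $a(n)^2\ge a(n-1)a(n+1)$ for all $n\ge 1$, and log-convex if $a(n)^2\le a(n-1)a(n+1)$ for all $n\ge 1$. *)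

theory Defs
  imports Complex_Main
begin

(* The three-term recurrence, indexed by Suc (Suc n) instead of n >= 2 and divided by
   its leading factor; gegenbauer_recurrence below gives it in the usual form.
   The function is total in the parameter \<nu>; the classical range is \<nu> > -1/2. *)
fun gegenbauer :: "real \<Rightarrow> nat \<Rightarrow> real \<Rightarrow> real" where
  "gegenbauer \<nu> 0 t = 1"
| "gegenbauer \<nu> (Suc 0) t = 2 * \<nu> * t"
| "gegenbauer \<nu> (Suc (Suc n)) t =
     (2 * t * (\<nu> + real (Suc (Suc n)) - 1) * gegenbauer \<nu> (Suc n) t
      - (2 * \<nu> + real (Suc (Suc n)) - 2) * gegenbauer \<nu> n t) / real (Suc (Suc n))"

lemma gegenbauer_recurrence:
  assumes "n \<ge> 2"
  shows "real n * gegenbauer \<nu> n t =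
           2 * t * (\<nu> + real n - 1) * gegenbauer \<nu> (n - 1) t
           - (2 * \<nu> + real n - 2) * gegenbauer \<nu> (n - 2) t"
proof -
  obtain m where "n = Suc (Suc m)"
    using assms by (metis Suc_diff_le Suc_1 add_2_eq_Suc le_Suc_ex)
  then show ?thesis by (simp del: of_nat_Suc)
qed

definition log_concave :: "(nat \<Rightarrow> real) \<Rightarrow> bool" where
  "log_concave a \<longleftrightarrow> (\<forall>n\<ge>1. (a n)\<^sup>2 \<ge> a (n - 1) * a (n + 1))"

definition log_convex :: "(nat \<Rightarrow> real) \<Rightarrow> bool" where
  "log_convex a \<longleftrightarrow> (\<forall>n\<ge>1. (a n)\<^sup>2 \<le> a (n - 1) * a (n + 1))"

end

theory Submission
  imports Defs
begin

text \<open>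
  With \<open>u n = (1 - \<nu>) / (n + 2)\<close> the recurrence reads
  \<open>C (n+2) = 2 t (1 - u n) C (n+1) - (1 - 2 u n) C n\<close>, so the Turan determinant at \<open>n + 1\<close> is the
  quadratic form \<open>Q (u n) (C n) (C (n+1))\<close> with
  \<open>Q u a b = b\<^sup>2 - 2 t a b + a\<^sup>2 + 2 u a (t b - a)\<close>. The recurrence multiplies this form by the
  nonnegative factor \<open>1 - 2 u n\<close>, and replacing \<open>u n\<close> by \<open>u (n+1)\<close> changes it by
  \<open>2 (u (n+1) - u n) b (t c - b)\<close>, where \<open>b = C (n+1)\<close> and \<open>c = C (n+2)\<close>. Since
  \<open>0 < C n \<le> t C (n+1)\<close>, this change has the sign of \<open>\<nu> - 1\<close>, so the sign of the determinant at \<open>1\<close>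
  propagates to every index.
\<close>

text \<open>Both \<open>\<nu>\<close> and \<open>n\<close> enter only through \<open>u\<close>, and
  \<open>2 * (1 - u)\<close> exceeds \<open>1 - 2 * u\<close> by exactly 1.\<close>

lemma gegenbauer_Suc_Suc:
  fixes \<nu> t :: real and n :: nat
  defines "u \<equiv> (1 - \<nu>) / (real n + 2)"
  shows "gegenbauer \<nu> (Suc (Suc n)) t =
    2 * t * (1 - u) * gegenbauer \<nu> (Suc n) t - (1 - 2 * u) * gegenbauer \<nu> n t"
proof -
  have "1 - u = (\<nu> + real n + 1) / (real n + 2)" "1 - 2 * u = (2 * \<nu> + real n) / (real n + 2)"
    unfolding u_def by (simp_all add: field_simps)
  then show ?thesis by (simp add: diff_divide_distrib add_ac)
qed

lemma gegenbauer_coeff_nonneg: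
  fixes \<nu> :: real
  assumes "\<nu> \<ge> 0"
  shows "1 - 2 * ((1 - \<nu>) / (real n + 2)) \<ge> 0"
  using assms by (simp add: field_simps)

text \<open>The hypothesis \<open>base\<close> is the ratio bound at \<open>n = 0\<close>. The
  factor \<open>t\<close> matters when \<open>\<nu> < 1/2\<close>: if
  \<open>2 * \<nu> * t\<^sup>2 = 1\<close>, the value at index 1 is \<open>1 / t\<close>, below the
  value 1 at index 0.\<close>

lemma gegenbauer_pos_and_ratio:
  fixes \<nu> t :: real
  assumes t: "t \<ge> 1" and \<nu>: "\<nu> \<ge> 0" and base: "2 * \<nu> * t\<^sup>2 \<ge> 1"
  shows "gegenbauer \<nu> n t > 0 \<and> gegenbauer \<nu> n t \<le> t * gegenbauer \<nu> (Suc n) t"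
proof (induction n)
  case 0
  show ?case using base by (simp add: power2_eq_square mult_ac)
next
  case (Suc n)
  define a b c u where "a = gegenbauer \<nu> n t" and "b = gegenbauer \<nu> (Suc n) t"
    and "c = gegenbauer \<nu> (Suc (Suc n)) t" and "u = (1 - \<nu>) / (real n + 2)"
  have c: "c = 2 * t * (1 - u) * b - (1 - 2 * u) * a"
    unfolding a_def b_def c_def u_def by (rule gegenbauer_Suc_Suc)
  have ab: "a > 0" "a \<le> t * b" using Suc by (simp_all add: a_def b_def)
  have b: "b > 0" using ab t by (smt (verit) zero_less_mult_pos)
  have "1 - 2 * u \<ge> 0"
    unfolding u_def using \<nu> by (rule gegenbauer_coeff_nonneg)
  \<comment> \<open>Bounding \<open>a\<close> by \<open>t * b\<close> in the recurrence leaves the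
    coefficient \<open>2 * (1 - u) - (1 - 2 * u) = 1\<close>.\<close>
  then have "(t * (1 - 2 * u)) * a \<le> (t * (1 - 2 * u)) * (t * b)"
    using ab t by (intro mult_left_mono) auto
  then have "t\<^sup>2 * b \<le> t * c"
    unfolding c by (simp add: algebra_simps power2_eq_square)
  moreover have "1 * b \<le> t\<^sup>2 * b"
    using t b by (intro mult_right_mono) auto
  ultimately show ?case using b unfolding b_def c_def by linarith
qed

text \<open>One induction serves both claims: \<open>\<sigma> = 1\<close> yields log-concavity and
  \<open>\<sigma> = -1\<close> log-convexity. The factor in \<open>base\<close> is the first Turan
  determinant divided by \<open>\<nu>\<close>.\<close>

lemma gegenbauer_turan_sign:
  fixes \<nu> t \<sigma> :: real
  assumes t: "t \<ge> 1" and \<nu>: "\<nu> \<ge> 0" and ratio: "2 * \<nu> * t\<^sup>2 \<ge> 1"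
    and \<sigma>: "\<sigma> * (\<nu> - 1) \<ge> 0" and base: "\<sigma> * (2 * (\<nu> - 1) * t\<^sup>2 + 1) \<ge> 0"
  shows "\<sigma> * ((gegenbauer \<nu> (Suc n) t)\<^sup>2
           - gegenbauer \<nu> n t * gegenbauer \<nu> (Suc (Suc n)) t) \<ge> 0"
proof (induction n)
  case 0
  have "(gegenbauer \<nu> (Suc 0) t)\<^sup>2 - gegenbauer \<nu> 0 t * gegenbauer \<nu> (Suc (Suc 0)) t
    = \<nu> * (2 * (\<nu> - 1) * t\<^sup>2 + 1)"
    by (simp add: field_simps power2_eq_square)
  then show ?case
    using mult_nonneg_nonneg[OF \<nu> base] by (simp only: mult.left_commute)
next
  case (Suc n)
  define a b c d where "a = gegenbauer \<nu> n t" and "b = gegenbauer \<nu> (Suc n) t"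
    and "c = gegenbauer \<nu> (Suc (Suc n)) t" and "d = gegenbauer \<nu> (Suc (Suc (Suc n))) t"
  define u v where "u = (1 - \<nu>) / (real n + 2)" and "v = (1 - \<nu>) / (real (Suc n) + 2)"
  have c: "c = 2 * t * (1 - u) * b - (1 - 2 * u) * a"
    unfolding a_def b_def c_def u_def by (rule gegenbauer_Suc_Suc)
  have d: "d = 2 * t * (1 - v) * c - (1 - 2 * v) * b"
    unfolding b_def c_def d_def v_def by (rule gegenbauer_Suc_Suc)
  \<comment> \<open>The first term is \<open>c\<^sup>2 - b * d\<close> with \<open>v\<close> set to
    \<open>u\<close> in \<open>d\<close>; there
    \<open>c - 2 * t * (1 - u) * b = - (1 - 2 * u) * a\<close> brings out the factor.\<close>
  have "c\<^sup>2 - b * d = (1 - 2 * u) * (b\<^sup>2 - a * c) + 2 * (v - u) * (b * (t * c - b))"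
    unfolding d c by algebra
  then have step: "\<sigma> * (c\<^sup>2 - b * d)
      = (1 - 2 * u) * (\<sigma> * (b\<^sup>2 - a * c)) + 2 * (\<sigma> * (v - u)) * (b * (t * c - b))"
    by algebra
  have vu: "v - u = (\<nu> - 1) / ((real n + 2) * (real n + 3))"
    unfolding u_def v_def by (simp add: divide_simps) (simp add: algebra_simps)
  have "\<sigma> * (v - u) = \<sigma> * (\<nu> - 1) / ((real n + 2) * (real n + 3))"
    unfolding vu by simp
  with \<sigma> have "\<sigma> * (v - u) \<ge> 0" by simp
  moreover have "b * (t * c - b) \<ge> 0"
    using gegenbauer_pos_and_ratio[OF t \<nu> ratio, of "Suc n"] unfolding b_def c_def by simp
  moreover have "1 - 2 * u \<ge> 0"
    unfolding u_def using \<nu> by (rule gegenbauer_coeff_nonneg)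
  moreover have "\<sigma> * (b\<^sup>2 - a * c) \<ge> 0"
    using Suc by (simp only: a_def b_def c_def)
  ultimately have "\<sigma> * (c\<^sup>2 - b * d) \<ge> 0"
    unfolding step by (metis add_nonneg_nonneg mult_nonneg_nonneg zero_le_numeral)
  then show ?case by (simp only: b_def c_def d_def)
qed

lemma log_concave_iff_Suc:
  "log_concave a \<longleftrightarrow> (\<forall>n. a n * a (Suc (Suc n)) \<le> (a (Suc n))\<^sup>2)"
  unfolding log_concave_def by (metis Suc_eq_plus1 Suc_le_D One_nat_def diff_Suc_1 le_add2)

lemma log_convex_iff_Suc:
  "log_convex a \<longleftrightarrow> (\<forall>n. (a (Suc n))\<^sup>2 \<le> a n * a (Suc (Suc n)))"
  unfolding log_convex_def by (metis Suc_eq_plus1 Suc_le_D One_nat_def diff_Suc_1 le_add2)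

lemma inverse_sqrt_le_imp:
  fixes x t :: real
  assumes "x > 0" "1 / sqrt x \<le> t"
  shows "1 \<le> x * t\<^sup>2"
proof -
  have "(1 / sqrt x)\<^sup>2 \<le> t\<^sup>2" using assms by (intro power_mono) auto
  with \<open>x > 0\<close> show ?thesis by (simp add: power_divide field_simps)
qed

theorem theorem4p8:
  "(\<forall>\<nu> t :: real. t \<ge> 1 \<and> \<nu> \<ge> 1 \<longrightarrow> log_concave (\<lambda>n. gegenbauer \<nu> n t)) \<and>
   (\<forall>\<nu> t :: real. 0 < \<nu> \<and> \<nu> < 1 \<and> t \<ge> max (1 / sqrt (2 * \<nu>)) (1 / sqrt (2 * (1 - \<nu>)))
      \<longrightarrow> log_convex (\<lambda>n. gegenbauer \<nu> n t))"
proof (intro conjI allI impI)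
  fix \<nu> t :: real
  assume h: "t \<ge> 1 \<and> \<nu> \<ge> 1"
  then have t2: "t\<^sup>2 \<ge> 1" by simp
  then have "\<nu> * t\<^sup>2 \<ge> 1" using h mult_mono[of 1 \<nu> 1 "t\<^sup>2"] by simp
  then have "2 * \<nu> * t\<^sup>2 \<ge> 1" by linarith
  then show "log_concave (\<lambda>n. gegenbauer \<nu> n t)"
    unfolding log_concave_iff_Suc using h gegenbauer_turan_sign[of t \<nu> 1] by simp
next
  fix \<nu> t :: real
  assume h: "0 < \<nu> \<and> \<nu> < 1 \<and> t \<ge> max (1 / sqrt (2 * \<nu>)) (1 / sqrt (2 * (1 - \<nu>)))"
  have b1: "1 \<le> 2 * \<nu> * t\<^sup>2" and b2: "1 \<le> 2 * (1 - \<nu>) * t\<^sup>2"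
    using h by (intro inverse_sqrt_le_imp; simp)+
  \<comment> \<open>Adding the two bounds cancels \<open>\<nu>\<close> and leaves
    \<open>2 \<le> 2 * t\<^sup>2\<close>.\<close>
  have t2: "1 \<le> t\<^sup>2" using b1 b2 by (simp add: algebra_simps)
  have "0 \<le> 1 / sqrt (2 * \<nu>)" using h by simp
  also have "\<dots> \<le> t" using h by simp
  finally have "0 \<le> t" .
  then have "t \<ge> 1" using t2 by (metis one_power2 power2_le_imp_le)
  moreover have "2 * (\<nu> - 1) * t\<^sup>2 + 1 \<le> 0" using b2 by (simp add: algebra_simps)
  ultimately show "log_convex (\<lambda>n. gegenbauer \<nu> n t)"
    unfolding log_convex_iff_Suc using h b1 gegenbauer_turan_sign[of t \<nu> "-1"] by simp
qed

end
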